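(* Let $m,n>0$ be real numbers and let $\varphi:(\mathrm{Sol}^3_{m,n},g)\to\mathbb{R}^d$ be the smooth map defined by $$\varphi(x,y,t)=\left(a_{11}x+a_{12}y+a_{13}t,\ a_{21}x+a_{22}y+a_{23}t,\ \dots,\ a_{d1}x+a_{d2}y+a_{d3}t\right),$$ where $a_{ij}\in\mathbb{R}$, $g=e^{-2mt}dx^2+e^{2nt}dy^2+dt^2$, and $\mathbb{R}^d$ carries the Euclidean metric. Then $\varphi$ is a harmonic map if and only if $m=n$.
   Context: For real $m,n>0$, $\mathrm{Sol}^3_{m,n}$ is the semidirect product $\mathbb{R}^2\rtimes_U\mathbb{R}$ with $U(t)=\mathrm{diag}(e^{mt},e^{-nt})$; its underlying manifold is $\mathbb{R}^3$ with global coordinates $(x,y,t)$. It carries the left-invariant Riemannian metric $g=e^{-2mt}dx^2+e^{2nt}dy^2+dt^2$. A smooth map $\varphi:(M,g_M)\to(N,h)$ of Riemannian manifolds is harmonic if its tension field $\tau(\varphi)=\operatorname{Tr}_{g_M}\nabla d\varphi$ vanishes; for $N=\mathbb{R}^d$ Euclidean, $\tau(\varphi)=(\Delta\varphi^1,\dots,\Delta\varphi^d)$ with $\Delta$ the Laplace operator of $g_M$.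
   Formalization: "Harmonic only if m = n" is proved under the added assumption that some a_{i3} is nonzero; without it the claim fails (e.g. a constant map is harmonic for all m, n). "Harmonic if m = n" is proved for all coefficients. *)

theory Defs
  imports "HOL-Analysis.Analysis"
begin

definition partial_deriv ::
    "'m::finite \<Rightarrow> (real ^ 'm \<Rightarrow> 'b::real_normed_vector) \<Rightarrow> real ^ 'm \<Rightarrow> 'b" where
  "partial_deriv i f x = frechet_derivative f (at x) (axis i 1)"

primrec Ck :: "nat \<Rightarrow> (real ^ 'm::finite \<Rightarrow> 'b::real_normed_vector) \<Rightarrow> bool" where
  "Ck 0 f \<longleftrightarrow> continuous_on UNIV f"
| "Ck (Suc k) f \<longleftrightarrow> f differentiable_on UNIV \<and> (\<forall>i. Ck k (partial_deriv i f))"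

definition smooth :: "(real ^ 'm::finite \<Rightarrow> 'b::real_normed_vector) \<Rightarrow> bool" where
  "smooth f \<longleftrightarrow> (\<forall>k. Ck k f)"

text \<open>
  A Riemannian metric on the manifold of real vectors with its single global chart is
  represented by its coefficient matrix, \<open>g x $ i $ j\<close> being the value of the metric at
  \<open>x\<close> on the coordinate fields number \<open>i\<close> and \<open>j\<close>.
\<close>

type_synonym 'm metric = "real ^ 'm \<Rightarrow> real ^ 'm ^ 'm"

text \<open>\<open>christoffel g k i j x\<close> is the Levi-Civita symbol with upper index \<open>k\<close> and lower
  indices \<open>i\<close>, \<open>j\<close>.\<close>

definition christoffel :: "'m::finite metric \<Rightarrow> 'm \<Rightarrow> 'm \<Rightarrow> 'm \<Rightarrow> real ^ 'm \<Rightarrow> real" where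
  "christoffel g k i j x =
     (1 / 2) * (\<Sum>l\<in>UNIV. matrix_inv (g x) $ k $ l *
        (partial_deriv i (\<lambda>y. g y $ j $ l) x
         + partial_deriv j (\<lambda>y. g y $ i $ l) x
         - partial_deriv l (\<lambda>y. g y $ i $ j) x))"

text \<open>
  The second fundamental form \<open>\<nabla>d\<phi>\<close> evaluated on the coordinate fields \<open>i\<close>, \<open>j\<close>, where
  \<open>\<nabla>\<close> is the connection on \<open>T\<^sup>*M \<otimes> \<phi>\<^sup>*TN\<close> induced by the Levi-Civita connections of
  \<open>g\<close> and \<open>h\<close>.
\<close>

definition second_fundamental_form ::
    "'m::finite metric \<Rightarrow> 'n::finite metric \<Rightarrow> (real ^ 'm \<Rightarrow> real ^ 'n) \<Rightarrow>
     'm \<Rightarrow> 'm \<Rightarrow> real ^ 'm \<Rightarrow> real ^ 'n" where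
  "second_fundamental_form g h \<phi> i j x = (\<chi> \<alpha>.
       partial_deriv i (partial_deriv j (\<lambda>y. \<phi> y $ \<alpha>)) x
     - (\<Sum>k\<in>UNIV. christoffel g k i j x * partial_deriv k (\<lambda>y. \<phi> y $ \<alpha>) x)
     + (\<Sum>\<beta>\<in>UNIV. \<Sum>\<gamma>\<in>UNIV. christoffel h \<alpha> \<beta> \<gamma> (\<phi> x) *
          partial_deriv i (\<lambda>y. \<phi> y $ \<beta>) x * partial_deriv j (\<lambda>y. \<phi> y $ \<gamma>) x))"

definition tension_field ::
    "'m::finite metric \<Rightarrow> 'n::finite metric \<Rightarrow> (real ^ 'm \<Rightarrow> real ^ 'n) \<Rightarrow>
     real ^ 'm \<Rightarrow> real ^ 'n" where
  "tension_field g h \<phi> x =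
     (\<Sum>i\<in>UNIV. \<Sum>j\<in>UNIV. matrix_inv (g x) $ i $ j *\<^sub>R second_fundamental_form g h \<phi> i j x)"

definition harmonic_map ::
    "'m::finite metric \<Rightarrow> 'n::finite metric \<Rightarrow> (real ^ 'm \<Rightarrow> real ^ 'n) \<Rightarrow> bool" where
  "harmonic_map g h \<phi> \<longleftrightarrow> smooth \<phi> \<and> (\<forall>x. tension_field g h \<phi> x = 0)"

definition flat_metric :: "'n::finite metric" where
  "flat_metric x = mat 1"

text \<open>The coordinates \<open>(x, y, t)\<close> of a point \<open>p\<close> of \<open>Sol\<^sup>3\<close> are \<open>p $ 1\<close>, \<open>p $ 2\<close>, \<open>p $ 3\<close>.\<close>

definition sol_metric :: "real \<Rightarrow> real \<Rightarrow> 3 metric" where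
  "sol_metric m n p = vector
     [vector [exp (- 2 * m * (p $ 3)), 0, 0],
      vector [0, exp (2 * n * (p $ 3)), 0],
      vector [0, 0, 1]]"

end

theory Submission
  imports Defs
begin

text \<open>
  The Christoffel symbols of the flat target vanish, and so do the second partial derivatives of a
  linear map \<open>f\<close>, so its tension field is \<open>- (\<Sum>k. (\<Sum>i j. g\<^sup>i\<^sup>j \<Gamma>\<^sup>k\<^sub>i\<^sub>j) f e\<^sub>k)\<close>. For the metric of
  \<open>Sol\<^sup>3\<close> the inner sum is \<open>0\<close> for \<open>k = 1, 2\<close> and \<open>m - n\<close> for \<open>k = 3\<close>, so that the tension field is
  the constant vector \<open>(n - m) f e\<^sub>3\<close>.
\<close>

lemma partial_deriv_eqI:
  assumes "(f has_derivative f') (at x)"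
  shows "partial_deriv i f x = f' (axis i 1)"
  using frechet_derivative_at[OF assms] by (simp add: partial_deriv_def)

lemma partial_deriv_const [simp]: "partial_deriv i (\<lambda>_. c) = (\<lambda>_. 0)"
  by (rule ext) (simp add: partial_deriv_eqI[OF has_derivative_const])

lemma partial_deriv_bounded_linear:
  "bounded_linear f \<Longrightarrow> partial_deriv i f = (\<lambda>_. f (axis i 1))"
  by (rule ext) (simp add: partial_deriv_eqI bounded_linear_imp_has_derivative)

lemma Ck_const: "Ck k (\<lambda>_. c)"
  by (induction k arbitrary: c) auto

text \<open>One differentiation already yields constants, so a case split on the order suffices and
  \<open>Ck_const\<close> does the rest.\<close>

lemma smooth_bounded_linear:
  assumes "bounded_linear f"
  shows "smooth f"
  unfolding smooth_def
proof
  fix k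
  show "Ck k f"
    using assms
    by (cases k) (auto simp: partial_deriv_bounded_linear Ck_const linear_continuous_on
        bounded_linear_imp_differentiable_on)
qed

lemma christoffel_flat_metric [simp]: "christoffel flat_metric k i j x = 0"
  by (simp add: christoffel_def flat_metric_def)

lemma tension_field_bounded_linear:
  fixes f :: "real ^ 'm \<Rightarrow> real ^ 'n"
  assumes "bounded_linear f"
  shows "tension_field g flat_metric f x =
    - (\<Sum>k\<in>UNIV. (\<Sum>i\<in>UNIV. \<Sum>j\<in>UNIV. matrix_inv (g x) $ i $ j * christoffel g k i j x)
        *\<^sub>R f (axis k 1))"
proof -
  have "bounded_linear (\<lambda>y. f y $ \<alpha>)" for \<alpha>
    using bounded_linear_compose[OF bounded_linear_vec_nth assms] .
  then have "second_fundamental_form g flat_metric f i j x =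
      - (\<Sum>k\<in>UNIV. christoffel g k i j x *\<^sub>R f (axis k 1))" for i j
    by (simp add: second_fundamental_form_def partial_deriv_bounded_linear vec_eq_iff)
  then have "tension_field g flat_metric f x =
      - (\<Sum>i\<in>UNIV. \<Sum>j\<in>UNIV. \<Sum>k\<in>UNIV.
          (matrix_inv (g x) $ i $ j * christoffel g k i j x) *\<^sub>R f (axis k 1))"
    by (simp add: tension_field_def scaleR_sum_right sum_negf)
  \<comment> \<open>Two exchanges move the sum over \<open>k\<close> outermost, where the vector
    \<open>f (axis k 1)\<close> can be factored out.\<close>
  also have "(\<Sum>i\<in>UNIV. \<Sum>j\<in>UNIV. \<Sum>k\<in>UNIV.
          (matrix_inv (g x) $ i $ j * christoffel g k i j x) *\<^sub>R f (axis k 1)) =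
      (\<Sum>i\<in>UNIV. \<Sum>k\<in>UNIV. \<Sum>j\<in>UNIV.
          (matrix_inv (g x) $ i $ j * christoffel g k i j x) *\<^sub>R f (axis k 1))"
    by (intro sum.cong refl sum.swap)
  also have "\<dots> = (\<Sum>k\<in>UNIV. \<Sum>i\<in>UNIV. \<Sum>j\<in>UNIV.
          (matrix_inv (g x) $ i $ j * christoffel g k i j x) *\<^sub>R f (axis k 1))"
    by (rule sum.swap)
  finally show ?thesis
    by (simp add: scaleR_sum_left)
qed

text \<open>\<open>matrix_inv\<close> is a Hilbert choice, whose property holds because
  \<open>B\<close> is a witness; cancelling \<open>A\<close> on the left by \<open>B\<close> then
  identifies the two.\<close>

lemma matrix_inv_unique:
  fixes A B :: "'a::semiring_1 ^ 'n ^ 'n"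
  assumes "A ** B = mat 1" and "B ** A = mat 1"
  shows "matrix_inv A = B"
proof -
  have "A ** matrix_inv A = mat 1"
    unfolding matrix_inv_def
    using someI[of "\<lambda>B. A ** B = mat 1 \<and> B ** A = mat 1" B] assms by blast
  then show ?thesis
    by (metis assms(2) matrix_mul_assoc matrix_mul_lid matrix_mul_rid)
qed

lemma matrix_inv_sol_metric:
  "matrix_inv (sol_metric m n p) = vector
     [vector [exp (2 * m * (p $ 3)), 0, 0],
      vector [0, exp (- 2 * n * (p $ 3)), 0],
      vector [0, 0, 1]]"
  by (rule matrix_inv_unique)
    (simp_all add: sol_metric_def vec_eq_iff matrix_matrix_mult_def sum_3 forall_3 mat_def
      flip: exp_add)

lemma partial_deriv_exp_coordinate:
  "partial_deriv i (\<lambda>p :: real ^ 'm::finite. exp (c * p $ l)) x =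
     (if i = l then c * exp (c * x $ l) else 0)"
proof -
  have "((\<lambda>p. exp (c * p $ l)) has_derivative (\<lambda>v. c * exp (c * x $ l) * v $ l)) (at x)"
    by (auto intro!: derivative_eq_intros bounded_linear_imp_has_derivative
        simp: bounded_linear_vec_nth)
  then show ?thesis
    by (simp add: partial_deriv_eqI axis_def)
qed

text \<open>The inverse metric is diagonal, so only symbols with equal lower indices count. The
  nonzero ones have upper index 3: \<open>m * exp (- 2 * m * t)\<close> for the pair 1, 1 and
  \<open>- n * exp (2 * n * t)\<close> for 2, 2. The inverse metric cancels both
  exponentials.\<close>

lemma contracted_christoffel_sol_metric:
  "(\<Sum>i\<in>UNIV. \<Sum>j\<in>UNIV.
      matrix_inv (sol_metric m n x) $ i $ j * christoffel (sol_metric m n) k i j x) =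
    (if k = 3 then m - n else 0)"
proof -
  \<comment> \<open>The minus sign stands outside the product because simplification brings the
    metric entry into that shape.\<close>
  have 1: "partial_deriv i (\<lambda>p :: real ^ 3. exp (- (2 * m * p $ 3))) x =
      (if i = 3 then - 2 * m * exp (- (2 * m * x $ 3)) else 0)" for i
    using partial_deriv_exp_coordinate[of i "- 2 * m" 3 x] by simp
  have 2: "partial_deriv i (\<lambda>p :: real ^ 3. exp (2 * n * p $ 3)) x =
      (if i = 3 then 2 * n * exp (2 * n * x $ 3) else 0)" for i
    by (rule partial_deriv_exp_coordinate)
  \<comment> \<open>Quantifying over \<open>k\<close> lets \<open>forall_3\<close> split the claim
    into the three coordinates.\<close>
  have "\<forall>k :: 3. (\<Sum>i\<in>UNIV. \<Sum>j\<in>UNIV.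
      matrix_inv (sol_metric m n x) $ i $ j * christoffel (sol_metric m n) k i j x) =
    (if k = 3 then m - n else 0)"
    unfolding christoffel_def matrix_inv_sol_metric
    by (simp add: forall_3 sum_3 sol_metric_def 1 2) (simp add: algebra_simps flip: exp_add)
  then show ?thesis by blast
qed

lemma tension_field_sol_metric_bounded_linear:
  assumes "bounded_linear f"
  shows "tension_field (sol_metric m n) flat_metric f x = (n - m) *\<^sub>R f (axis 3 1)"
proof -
  have "tension_field (sol_metric m n) flat_metric f x =
      - (\<Sum>k\<in>UNIV. (if k = 3 then m - n else 0) *\<^sub>R f (axis k 1))"
    unfolding tension_field_bounded_linear[OF assms] contracted_christoffel_sol_metric ..
  then show ?thesis
    by (simp add: sum_3 flip: scaleR_minus_left)
qed

text \<open>The tension field is \<open>n - m\<close> times the third column of \<open>a\<close>. If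
  that column is zero, the map is harmonic for all \<open>m\<close> and \<open>n\<close>, so the
  equivalence needs a nonzero entry there.\<close>

theorem theorem5:
  fixes m n :: real
    and a :: "real ^ 3 ^ 'd"
    and \<phi> :: "real ^ 3 \<Rightarrow> real ^ 'd"
  assumes "m > 0" and "n > 0"
    and "\<phi> = (\<lambda>p. \<chi> i. a $ i $ 1 * p $ 1 + a $ i $ 2 * p $ 2 + a $ i $ 3 * p $ 3)"
  shows "(m = n \<longrightarrow> harmonic_map (sol_metric m n) flat_metric \<phi>) \<and>
    ((\<exists>i. a $ i $ 3 \<noteq> 0) \<longrightarrow>
       (harmonic_map (sol_metric m n) flat_metric \<phi> \<longleftrightarrow> m = n))"
proof -
  have "\<phi> = (*v) a"
    by (rule ext) (simp add: assms(3) vec_eq_iff matrix_vector_mult_def sum_3)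
  then have lin: "bounded_linear \<phi>"
    by simp
  have "\<phi> (axis 3 1) = (\<chi> i. a $ i $ 3)"
    by (simp add: assms(3) axis_def)
  then have "harmonic_map (sol_metric m n) flat_metric \<phi> \<longleftrightarrow> m = n \<or> (\<forall>i. a $ i $ 3 = 0)"
    by (auto simp: harmonic_map_def smooth_bounded_linear[OF lin]
        tension_field_sol_metric_bounded_linear[OF lin] vec_eq_iff)
  then show ?thesis
    by blast
qed

end
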